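(* Let $$\Delta=\left\{\left(\frac{r}{q},\frac{q-1}{q}\right)\ \middle|\ r,q\in\mathbb{Z},\ 0<r<q,\ \gcd(r,q)=1\right\}\subset\mathbb{R}^2 .$$ Consider two families of lines in $\mathbb{R}^2$: the "green" family, consisting of the lines passing through the point $(0,1)$ with slope $-\frac1m$, $m=1,2,\dots$; and the "red" family, consisting of the lines passing through the point $(1,1)$ with slope $\frac1k$, $k=1,2,\dots$. Let $\Delta'\subset\mathbb{R}^2$ be the set of all intersection points of a line of the green family with a line of the red family. Then $\Delta$ is the subset of $\Delta'$ formed by the points with the least possible ordinate for given abscissa: $$\Delta=\{(x,y)\in\Delta' \mid \forall\, y'<y,\ (x,y')\notin\Delta'\}.$$
   Context: The set $\Delta$ is the projection to the $xy$-plane of one of the three families of vertices of the graph of the function $R_{ab}$ (the maximal translation number of a product of two lifts of circle homeomorphisms with prescribed translation numbers), namely the family $\left(\frac{r}{q},1-\frac1q,1+\frac{r}{q}\right)$ with coprime $0<r<q$. The claim only uses the explicit description of $\Delta$. The green lines have equations $y=1-\frac{x}{m}$ and the red lines have equations $y=\frac{k-1}{k}+\frac{x}{k}$, $m,k\in\{1,2,\dots\}$. *)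

theory Defs
  imports Complex_Main
begin

definition line_with_slope :: "real \<times> real \<Rightarrow> real \<Rightarrow> (real \<times> real) set" where
  "line_with_slope p s = {(x, y). y - snd p = s * (x - fst p)}"

definition green_lines :: "(real \<times> real) set set" where
  "green_lines = {line_with_slope (0, 1) (- 1 / real m) | m :: nat. m \<ge> 1}"

definition red_lines :: "(real \<times> real) set set" where
  "red_lines = {line_with_slope (1, 1) (1 / real k) | k :: nat. k \<ge> 1}"

definition Delta :: "(real \<times> real) set" where
  "Delta = {(of_int r / of_int q, of_int (q - 1) / of_int q) | r q :: int.
              0 < r \<and> r < q \<and> gcd r q = 1}"

text \<open>
  A green line has negative slope and a red line has positive slope, so the two never
  coincide and their common points are exactly their intersection point.
\<close>

definition Delta' :: "(real \<times> real) set" where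
  "Delta' = (\<Union>g \<in> green_lines. \<Union>l \<in> red_lines. g \<inter> l)"

end

(* The green line of slope -1/m and the red line of slope 1/k meet in (m/n, 1 - 1/n) with
   n = m + k, so Delta' is Delta without the coprimality condition.  Writing the abscissa as a
   fraction m/n, the ordinate 1 - 1/n grows with n, so it is least for the reduced fraction. *)
theory Submission
  imports Defs
begin

lemma mem_Delta'_iff:
  "(x, y) \<in> Delta' \<longleftrightarrow>
    (\<exists>m n :: int. 0 < m \<and> m < n \<and> x = of_int m / of_int n \<and> y = 1 - 1 / of_int n)"
proof
  assume "(x, y) \<in> Delta'"
  then obtain m k :: nat where pos: "m \<ge> 1" "k \<ge> 1"
    and green: "y - 1 = - 1 / real m * x" and red: "y - 1 = 1 / real k * (x - 1)"
    by (auto simp: Delta'_def green_lines_def red_lines_def line_with_slope_def)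
  \<comment> \<open>Equating the two values of \<open>y - 1\<close> gives
    \<open>k * x = m * (1 - x)\<close>: the abscissa divides the unit interval in the ratio m :
    k.\<close>
  have x: "x = real m / (real m + real k)"
    using green red pos by (simp add: field_simps)
  have y: "y = 1 - 1 / (real m + real k)"
    using green pos unfolding x by (simp add: field_simps)
  show "\<exists>m n :: int. 0 < m \<and> m < n \<and> x = of_int m / of_int n \<and> y = 1 - 1 / of_int n"
    using pos x y by (intro exI[of _ "int m"] exI[of _ "int m + int k"]) simp
next
  assume "\<exists>m n :: int. 0 < m \<and> m < n \<and> x = of_int m / of_int n \<and> y = 1 - 1 / of_int n"
  then obtain m n :: int where mn: "0 < m" "m < n"
    and xy: "x = of_int m / of_int n" "y = 1 - 1 / of_int n"
    by blast
  \<comment> \<open>The lines through a given point are read off from the fraction: the numerator m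
    fixes the green slope and the gap n - m the red one. Both are positive because 0 < m < n, so
    passing to \<open>nat\<close> loses nothing.\<close>
  have "(x, y) \<in> line_with_slope (0, 1) (- 1 / real (nat m))"
    using mn by (simp add: line_with_slope_def xy field_simps)
  moreover have "(x, y) \<in> line_with_slope (1, 1) (1 / real (nat (n - m)))"
    using mn by (simp add: line_with_slope_def xy field_simps)
  moreover have "nat m \<ge> 1" "nat (n - m) \<ge> 1"
    using mn by simp_all
  ultimately show "(x, y) \<in> Delta'"
    unfolding Delta'_def green_lines_def red_lines_def by blast
qed

lemma mem_Delta_iff:
  "(x, y) \<in> Delta \<longleftrightarrow>
    (\<exists>r q :: int. 0 < r \<and> r < q \<and> coprime r q \<and> x = of_int r / of_int q \<and> y = 1 - 1 / of_int q)"
proof -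
  have "of_int (q - 1) / of_int q = 1 - 1 / real_of_int q" if "0 < r" "r < q" for r q :: int
    using that by (simp add: diff_divide_distrib)
  then show ?thesis
    unfolding Delta_def coprime_iff_gcd_eq_1 mem_Collect_eq prod.inject by metis
qed

text \<open>Cross-multiplication gives \<open>m * q = r * n\<close>, so q divides
  \<open>r * n\<close>, and by coprimality it divides n. This is what turns reducedness into
  minimality of the ordinate.\<close>

lemma reduced_denominator_le:
  fixes r q m n :: int
  assumes "coprime r q" "0 < q" "0 < n" "real_of_int m / of_int n = of_int r / of_int q"
  shows "q \<le> n"
proof -
  have "real_of_int (m * q) = real_of_int (r * n)"
    using assms by (simp add: field_simps)
  then have "m * q = r * n"
    by (simp only: of_int_eq_iff)
  then have "q dvd r * n"
    by (metis dvd_triv_right)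
  then have "q dvd n"
    using \<open>coprime r q\<close> by (simp add: coprime_dvd_mult_right_iff coprime_commute)
  then show ?thesis
    using \<open>0 < n\<close> by (rule zdvd_imp_le)
qed

theorem theorem5:
  "Delta = {(x, y). (x, y) \<in> Delta' \<and> (\<forall>y'<y. (x, y') \<notin> Delta')}"
proof -
  have "(x, y) \<in> Delta \<longleftrightarrow> (x, y) \<in> Delta' \<and> (\<forall>y'<y. (x, y') \<notin> Delta')" for x y
  proof (intro iffI conjI allI impI notI)
    assume "(x, y) \<in> Delta"
    then obtain r q :: int where rq: "0 < r" "r < q" "coprime r q"
      and xy: "x = of_int r / of_int q" "y = 1 - 1 / of_int q"
      unfolding mem_Delta_iff by blast
    show "(x, y) \<in> Delta'"
      unfolding mem_Delta'_iff using rq xy by blast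
    fix y' assume "y' < y" "(x, y') \<in> Delta'"
    then obtain m n :: int where mn: "0 < m" "m < n"
      and x: "x = of_int m / of_int n" and y': "y' = 1 - 1 / of_int n"
      unfolding mem_Delta'_iff by blast
    have "q \<le> n"
      using reduced_denominator_le[of r q n m] rq mn x xy by simp
    then have "1 / real_of_int n \<le> 1 / of_int q"
      using rq by (simp add: frac_le)
    then show False
      using \<open>y' < y\<close> y' xy by simp
  next
    assume "(x, y) \<in> Delta' \<and> (\<forall>y'<y. (x, y') \<notin> Delta')"
    then obtain m n :: int where mn: "0 < m" "m < n"
      and xy: "x = of_int m / of_int n" "y = 1 - 1 / of_int n"
      and least: "\<forall>y'<y. (x, y') \<notin> Delta'"
      unfolding mem_Delta'_iff by blast
    \<comment> \<open>Cancelling the gcd keeps the abscissa and yields a competing point of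
      \<open>Delta'\<close> above it, whose ordinate is governed by q instead of n.\<close>
    define d where "d = gcd m n"
    obtain r q where rq: "m = r * d" "n = q * d" "coprime r q"
      using gcd_coprime_exists[of m n] mn unfolding d_def by auto
    have "d > 0"
      using mn by (simp add: d_def)
    then have pos: "0 < r" "r < q"
      using mn by (simp_all add: rq zero_less_mult_iff)
    have x: "x = of_int r / of_int q"
      using \<open>d > 0\<close> by (simp add: xy rq)
    then have "(x, 1 - 1 / of_int q) \<in> Delta'"
      unfolding mem_Delta'_iff using pos by blast
    \<comment> \<open>By \<open>least\<close> the competitor cannot lie strictly below y, which
      bounds n by q. Together with q \<le> n this forces q = n, so the fraction m/n was already
      reduced.\<close>
    then have "1 / real_of_int q \<le> 1 / of_int n"
      using least xy by force
    then have "n \<le> q"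
      using pos mn by (simp add: field_simps)
    moreover have "q \<le> n"
      using reduced_denominator_le[of r q n m] rq(3) pos mn x xy by simp
    ultimately have "y = 1 - 1 / of_int q"
      by (simp add: xy)
    then show "(x, y) \<in> Delta"
      unfolding mem_Delta_iff using rq pos x by blast
  qed
  then show ?thesis
    by auto
qed

end
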